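(* For every $\ell\ge 1$, we have $$\delta^+_\chi(\overrightarrow{C}_{2\ell+1},2)=\frac12 ,$$ where $\overrightarrow{C}_{2\ell+1}$ is the directed cycle on $2\ell+1$ vertices.
   Context: All digraphs are finite, may contain anti-parallel arcs (both $(u,v)$ and $(v,u)$), and have no loops or parallel arcs. $|D|$ is the number of vertices of $D$ and $\delta^+(D)$ its minimum out-degree. The underlying graph $G(D)$ is the simple graph on $V(D)$ in which $\{u,v\}$ is an edge iff $(u,v)$ or $(v,u)$ is an arc of $D$; $\chi(D)$ is the chromatic number of $G(D)$. $H\subseteq D$ means that $D$ contains a (not necessarily induced) subdigraph isomorphic to $H$. The chromatic profile of a digraph $H$ is $$\delta^+_\chi(H,k):=\inf\{d:\ \delta^+(D)\ge d|D| \text{ and } H\not\subseteq D \Rightarrow \chi(D)\le k\},$$ where the implication is over digraphs $D$.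
   Formalization: In the chromatic profile the implication is required only for all sufficiently large digraphs D (threshold depending on H, k, d); read over all D the claim fails for ℓ≥2, as the complete digraph on 2ℓ vertices shows. For ℓ=1 both readings agree by blow-up. *)

theory Defs
  imports Complex_Main
    "Graph_Theory.Digraph_Component"
    "Graph_Theory.Digraph_Isomorphism"
begin

definition min_out_degree :: "('a, 'b) pre_digraph \<Rightarrow> nat" where
  "min_out_degree D = Min (out_degree D ` verts D)"

definition contains_digraph :: "('a, 'b) pre_digraph \<Rightarrow> ('c, 'd) pre_digraph \<Rightarrow> bool" where
  "contains_digraph H D \<longleftrightarrow> (\<exists>K. subgraph K D \<and> digraph_iso H K)"

definition colorable :: "('a, 'b) pre_digraph \<Rightarrow> nat \<Rightarrow> bool" where
  "colorable G k \<longleftrightarrow>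
    (\<exists>c :: 'a \<Rightarrow> nat. c ` verts G \<subseteq> {..<k} \<and> (\<forall>(u, v) \<in> arcs_ends G. c u \<noteq> c v))"

text \<open>As in the library, the underlying simple graph of a digraph is represented by the symmetric
  digraph \<^const>\<open>mk_symmetric\<close>.\<close>

definition chromatic_number :: "('a, 'b) pre_digraph \<Rightarrow> nat" where
  "chromatic_number D = (LEAST k. colorable (with_proj (mk_symmetric D)) k)"

text \<open>Vertices are natural numbers, which represents every finite digraph up to isomorphism.

  The implication is required only of all sufficiently large digraphs (in terms of \<open>H\<close>, \<open>k\<close>, \<open>d\<close>).
  Without this, digraphs that avoid \<open>H\<close> merely because they are too small dominate the infimum:
  the complete digraph on \<open>m - 1\<close> vertices does not contain the directed cycle on \<open>m\<close> vertices, but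
  has minimum out-degree \<open>m - 2\<close> and chromatic number \<open>m - 1\<close>.\<close>

definition chromatic_profile :: "('a, 'b) pre_digraph \<Rightarrow> nat \<Rightarrow> real" where
  "chromatic_profile H k = Inf {d. \<exists>n\<^sub>0. \<forall>D :: nat pair_pre_digraph.
     pair_digraph D \<and> n\<^sub>0 \<le> card (pverts D) \<and>
     d * real (card (pverts D)) \<le> real (min_out_degree (with_proj D)) \<and>
     \<not> contains_digraph H (with_proj D) \<longrightarrow>
     chromatic_number (with_proj D) \<le> k}"

definition directed_cycle :: "nat \<Rightarrow> nat pair_pre_digraph" where
  "directed_cycle n = \<lparr> pverts = {..<n}, parcs = {(i, Suc i mod n) | i. i < n} \<rparr>"

end

theory Submission
  imports Defs
begin

text \<open>If every out-degree exceeds \<open>(1/2 + \<epsilon>)n\<close>, some vertex \<open>u\<close> has in-degree at least as large.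
  A greedy path starting in \<open>u\<close> and ending in \<open>v\<close> closes up to a directed cycle of any prescribed
  length, because the out-neighbourhood of \<open>v\<close> and the in-neighbourhood of \<open>u\<close> share at least
  \<open>2\<epsilon>n\<close> vertices. So for \<open>d > 1/2\<close> the colouring condition holds vacuously. For the lower bound,
  add to a balanced complete bipartite digraph a source joined to all other vertices: no directed
  cycle passes through the source, so all of them are even, but there are triangles in the
  underlying graph.\<close>

section \<open>Containment as an injective vertex map\<close>

text \<open>An arc here is the pair of its ends, so an isomorphism onto a subdigraph is determined
  by its vertex map.\<close>

lemma contains_digraph_with_proj_iff:
  assumes "pair_wf_digraph H" "pair_wf_digraph D"
  shows "contains_digraph (with_proj H) (with_proj D) \<longleftrightarrow>
    (\<exists>f. inj_on f (pverts H) \<and> f ` pverts H \<subseteq> pverts D \<and> map_prod f f ` parcs H \<subseteq> parcs D)"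
    (is "?L \<longleftrightarrow> ?R")
proof
  assume ?L
  then obtain h where sub: "subgraph (app_iso h (with_proj H)) (with_proj D)"
    and iso: "pre_digraph.digraph_isomorphism (with_proj H) h"
    unfolding contains_digraph_def digraph_iso_def by blast
  \<comment> \<open>Compatibility with \<open>with_proj D\<close> forces tail and head of the image
    to be \<open>fst\<close> and \<open>snd\<close>, which fixes \<open>iso_arcs h\<close>.\<close>
  have ends: "iso_arcs h e = map_prod (iso_verts h) (iso_verts h) e" if "e \<in> parcs H" for e
    using iso sub that
    by (auto simp: pre_digraph.digraph_isomorphism_def subgraph_def compatible_def
        map_prod_def split_beta prod_eq_iff)
  show ?R
  proof (intro exI conjI)
    show "inj_on (iso_verts h) (pverts H)"
      using iso by (simp add: pre_digraph.digraph_isomorphism_def)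
    show "iso_verts h ` pverts H \<subseteq> pverts D"
      using sub by (simp add: subgraph_def)
    show "map_prod (iso_verts h) (iso_verts h) ` parcs H \<subseteq> parcs D"
      using sub ends by (auto simp: subgraph_def image_subset_iff)
  qed
next
  interpret H: pair_wf_digraph H by fact
  interpret D: pair_wf_digraph D by fact
  assume ?R
  then obtain f where f: "inj_on f (pverts H)" "f ` pverts H \<subseteq> pverts D"
    "map_prod f f ` parcs H \<subseteq> parcs D" by blast
  define h where "h = \<lparr>iso_verts = f, iso_arcs = map_prod f f,
    iso_head = snd, iso_tail = fst\<rparr>"
  have "parcs H \<subseteq> pverts H \<times> pverts H"
    by (auto dest: H.wellformed')
  then have "inj_on (map_prod f f) (parcs H)"
    using map_prod_inj_on[OF f(1) f(1)] inj_on_subset by blast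
  then have iso: "pre_digraph.digraph_isomorphism (with_proj H) h"
    using f(1) H.wf_digraph
    by (simp add: pre_digraph.digraph_isomorphism_def h_def)
  moreover have "subgraph (app_iso h (with_proj H)) (with_proj D)"
    unfolding subgraph_def compatible_def
    using f H.wf_digraphI_app_iso[OF iso] D.wf_digraph by (simp add: h_def)
  ultimately show ?L
    unfolding contains_digraph_def digraph_iso_def by blast
qed

section \<open>Colourings and degrees\<close>

lemma colorable_mono: "colorable G j \<Longrightarrow> j \<le> k \<Longrightarrow> colorable G k"
  unfolding colorable_def by (meson dual_order.trans lessThan_subset_iff)

text \<open>Pairwise different colours are proper since there are no loops. Hence the
  \<open>LEAST\<close> in \<open>chromatic_number\<close> is attained.\<close>

lemma (in pair_digraph) colorable_mk_symmetric_card: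
  "colorable (with_proj (mk_symmetric (with_proj G))) (card (pverts G))"
proof -
  obtain c where c: "bij_betw c (pverts G) {..<card (pverts G)}"
    using ex_bij_betw_finite_nat[OF pair_finite_verts] by (auto simp: atLeast0LessThan)
  have "c (fst e) \<noteq> c (snd e)" if "e \<in> parcs G" for e
    using that c pair_no_loops[OF that] arc_fst_in_verts arc_snd_in_verts
    by (auto simp: bij_betw_def dest: inj_onD)
  then show ?thesis
    unfolding colorable_def using c
    by (intro exI[of _ c]) (fastforce simp: bij_betw_def parcs_mk_symmetric)
qed

lemma (in pair_digraph) chromatic_number_le_iff:
  "chromatic_number (with_proj G) \<le> k \<longleftrightarrow> colorable (with_proj (mk_symmetric (with_proj G))) k"
proof
  have "colorable (with_proj (mk_symmetric (with_proj G))) (chromatic_number (with_proj G))"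
    unfolding chromatic_number_def using colorable_mk_symmetric_card by (rule LeastI)
  then show "chromatic_number (with_proj G) \<le> k
      \<Longrightarrow> colorable (with_proj (mk_symmetric (with_proj G))) k"
    by (rule colorable_mono)
qed (simp add: chromatic_number_def Least_le)

lemma out_degree_with_proj: "out_degree (with_proj D) v = card (parcs D `` {v})"
proof -
  have "out_arcs (with_proj D) v = Pair v ` (parcs D `` {v})"
    by (auto simp: out_arcs_def)
  then show ?thesis
    by (simp add: out_degree_def card_image inj_on_def)
qed

lemma pair_wf_digraph_directed_cycle: "pair_wf_digraph (directed_cycle m)"
  by unfold_locales (auto simp: directed_cycle_def)

section \<open>Directed cycles from large out-degrees\<close>

context pair_fin_digraph
begin

text \<open>The last vertex of the path always has more out-neighbours than the path has vertices,
  so one of them is new. The count includes the last vertex itself, so a loop does no harm.\<close>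

lemma greedy_path:
  assumes "u \<in> pverts G" and "\<And>v. v \<in> pverts G \<Longrightarrow> k < card (parcs G `` {v})"
  shows "\<exists>p. p 0 = u \<and> inj_on p {..k} \<and> p ` {..k} \<subseteq> pverts G \<and> (\<forall>i<k. (p i, p (Suc i)) \<in> parcs G)"
  using assms(2)
proof (induction k)
  case 0
  then show ?case using assms(1) by (intro exI[of _ "\<lambda>_. u"]) auto
next
  case (Suc k)
  then obtain p where p: "p 0 = u" "inj_on p {..k}" "p ` {..k} \<subseteq> pverts G"
      "\<forall>i<k. (p i, p (Suc i)) \<in> parcs G"
    using Suc_lessD by metis
  have "card (p ` {..k}) < card (parcs G `` {p k})"
    using Suc.prems[of "p k"] p(3) card_image_le[of "{..k}" p] by force
  then obtain w where w: "(p k, w) \<in> parcs G" "w \<notin> p ` {..k}"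
    by (metis Image_singleton_iff card_mono finite_atMost finite_imageI leD subsetI)
  show ?case
  proof (intro exI conjI allI impI)
    show "inj_on (p(Suc k := w)) {..Suc k}"
      using p(2) w(2) by (auto simp: atMost_Suc inj_on_def)
    show "(p(Suc k := w)) ` {..Suc k} \<subseteq> pverts G"
      using p(3) w(1) in_arcsD2 by (auto simp: atMost_Suc)
    show "((p(Suc k := w)) i, (p(Suc k := w)) (Suc i)) \<in> parcs G" if "i < Suc k" for i
      using p(4) w(1) that by (auto simp: less_Suc_eq)
  qed (use p(1) in simp)
qed

text \<open>Double counting: out-degrees and in-degrees both sum to the number of arcs.\<close>

lemma ex_in_degree_ge:
  assumes "pverts G \<noteq> {}" and "\<And>v. v \<in> pverts G \<Longrightarrow> k \<le> card (parcs G `` {v})"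
  shows "\<exists>v\<in>pverts G. k \<le> card ((parcs G)\<inverse> `` {v})"
proof (rule ccontr)
  assume "\<not> ?thesis"
  then have less: "\<And>v. v \<in> pverts G \<Longrightarrow> card ((parcs G)\<inverse> `` {v}) < k" by force
  have fin: "finite (parcs G `` {v})" "finite ((parcs G)\<inverse> `` {v})" for v
    using pair_finite_arcs by (auto intro: finite_Image)
  have "(\<Sum>v\<in>pverts G. card (parcs G `` {v})) = card (SIGMA v:pverts G. parcs G `` {v})"
    using pair_finite_verts fin by (simp add: card_SigmaI)
  \<comment> \<open>Swapping the pairs turns arcs grouped by tail into arcs grouped by head.\<close>
  also have "(SIGMA v:pverts G. parcs G `` {v}) = prod.swap ` (SIGMA v:pverts G. (parcs G)\<inverse> `` {v})"
    by (auto dest: wellformed' simp: image_iff)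
  also have "card \<dots> = (\<Sum>v\<in>pverts G. card ((parcs G)\<inverse> `` {v}))"
    using pair_finite_verts fin by (simp add: card_image card_SigmaI)
  also have "\<dots> < (\<Sum>v\<in>pverts G. k)"
    using less assms(1) pair_finite_verts by (intro sum_strict_mono) auto
  also have "\<dots> \<le> (\<Sum>v\<in>pverts G. card (parcs G `` {v}))"
    using assms(2) by (rule sum_mono)
  finally show False by simp
qed

lemma contains_directed_cycle:
  assumes "pverts G \<noteq> {}" and "2 \<le> m"
    and deg: "\<And>v. v \<in> pverts G \<Longrightarrow> k \<le> card (parcs G `` {v})"
    and large: "card (pverts G) + m \<le> 2 * k"
  shows "contains_digraph (with_proj (directed_cycle m)) (with_proj G)"
proof -
  obtain u where u: "u \<in> pverts G" "k \<le> card ((parcs G)\<inverse> `` {u})"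
    using ex_in_degree_ge[OF assms(1) deg] by blast
  have sub: "parcs G `` {v} \<subseteq> pverts G" "(parcs G)\<inverse> `` {v} \<subseteq> pverts G" for v
    by (auto dest: wellformed')
  have "k \<le> card (pverts G)"
    using deg[OF u(1)] card_mono[OF pair_finite_verts sub(1)] by (meson le_trans)
  \<comment> \<open>No out-degree exceeds the number of vertices, so \<open>large\<close> leaves
    room for the greedy path.\<close>
  then have "m \<le> k" using large by simp
  \<comment> \<open>The path fills positions \<open>0\<close> to \<open>j\<close>, which is
    \<open>m - 1\<close> vertices; position \<open>Suc j\<close> is kept for the vertex that closes
    the cycle.\<close>
  obtain j where m: "m = Suc (Suc j)"
    using assms(2) by (metis add_2_eq_Suc le_Suc_ex)
  have "j < card (parcs G `` {v})" if "v \<in> pverts G" for v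
    using deg[OF that] \<open>m \<le> k\<close> m by simp
  from greedy_path[OF u(1) this] obtain p where p: "p 0 = u" "inj_on p {..j}"
      "p ` {..j} \<subseteq> pverts G" "\<forall>i<j. (p i, p (Suc i)) \<in> parcs G" by blast
  \<comment> \<open>Any vertex of \<open>N\<close> off the path closes it up. By inclusion-exclusion
    \<open>N\<close> has at least \<open>2 * k - card (pverts G)\<close> vertices, hence at least
    \<open>m\<close>.\<close>
  define N where "N = parcs G `` {p j} \<inter> (parcs G)\<inverse> `` {u}"
  have fin: "finite (parcs G `` {p j})" "finite ((parcs G)\<inverse> `` {u})"
    using sub pair_finite_verts by (meson finite_subset)+
  have "card (parcs G `` {p j}) + card ((parcs G)\<inverse> `` {u})
      = card (parcs G `` {p j} \<union> (parcs G)\<inverse> `` {u}) + card N"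
    unfolding N_def by (rule card_Un_Int[OF fin])
  moreover have "card (parcs G `` {p j} \<union> (parcs G)\<inverse> `` {u}) \<le> card (pverts G)"
    using sub by (intro card_mono pair_finite_verts) auto
  moreover have "k \<le> card (parcs G `` {p j})"
    using deg p(3) by auto
  ultimately have "m \<le> card N" using u(2) large by linarith
  then have "card (p ` {..j}) < card N"
    using card_image_le[of "{..j}" p] m by simp
  then obtain w where w: "w \<in> N" "w \<notin> p ` {..j}"
    by (metis card_mono finite_atMost finite_imageI leD subsetI)
  define q where "q = p(Suc j := w)"
  have lt: "{..<m} = insert (Suc j) {..j}" using m by auto
  have "inj_on q {..<m}"
    unfolding lt q_def using p(2) w(2) by (auto simp: inj_on_def)
  moreover have "q ` {..<m} \<subseteq> pverts G"
    unfolding lt q_def using p(3) w(1) sub by (auto simp: N_def)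
  moreover have "(q i, q (Suc i mod m)) \<in> parcs G" if i: "i < m" for i
  proof -
    \<comment> \<open>An arc of the path, the arc into \<open>w\<close>, and the arc from
      \<open>w\<close> back to \<open>u\<close>, where the index wraps to \<open>0\<close>.\<close>
    consider "i < j" | "i = j" | "i = Suc j"
      using i unfolding m less_Suc_eq by blast
    then show ?thesis using p(1,4) w(1) m by cases (auto simp: q_def N_def)
  qed
  then have "map_prod q q ` parcs (directed_cycle m) \<subseteq> parcs G"
    by (auto simp: directed_cycle_def)
  ultimately show ?thesis
    unfolding contains_digraph_with_proj_iff[OF pair_wf_digraph_directed_cycle pair_wf_digraph_axioms]
    by (auto simp: directed_cycle_def)
qed

end

lemma eventually_contains_directed_cycle:
  fixes d :: real
  assumes "1 / 2 < d" "2 \<le> m"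
  shows "\<exists>n\<^sub>0. \<forall>D :: 'a pair_pre_digraph. pair_fin_digraph D \<and> n\<^sub>0 \<le> card (pverts D) \<and>
    d * real (card (pverts D)) \<le> real (min_out_degree (with_proj D)) \<longrightarrow>
    contains_digraph (with_proj (directed_cycle m)) (with_proj D)"
proof -
  \<comment> \<open>Beyond this bound \<open>2 * d * n\<close> exceeds \<open>n + m\<close>, where
    \<open>n\<close> is the number of vertices; this gives the \<open>large\<close> hypothesis of
    \<open>contains_directed_cycle\<close>.\<close>
  obtain n\<^sub>0 :: nat where n0: "real m / (2 * d - 1) < real n\<^sub>0"
    using reals_Archimedean2 by blast
  show ?thesis
  proof (intro exI[of _ "Suc n\<^sub>0"] allI impI, elim conjE)
    fix D :: "'a pair_pre_digraph"
    assume "pair_fin_digraph D" and n: "Suc n\<^sub>0 \<le> card (pverts D)"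
      and d: "d * real (card (pverts D)) \<le> real (min_out_degree (with_proj D))"
    interpret pair_fin_digraph D by fact
    have "real m / (2 * d - 1) < real (card (pverts D))" using n0 n by linarith
    then have "real m < (2 * d - 1) * real (card (pverts D))"
      using assms(1) by (simp add: field_simps)
    then have "card (pverts D) + m \<le> 2 * min_out_degree (with_proj D)"
      using d by (simp add: algebra_simps)
    moreover have "min_out_degree (with_proj D) \<le> card (parcs D `` {v})" if "v \<in> pverts D" for v
      using that pair_finite_verts
      by (simp add: min_out_degree_def flip: out_degree_with_proj)
    moreover have "pverts D \<noteq> {}" using n by auto
    ultimately show "contains_digraph (with_proj (directed_cycle m)) (with_proj D)"
      using assms(2) by (intro contains_directed_cycle)
  qed
qed

section \<open>Extremal digraphs for the lower bound\<close>

text \<open>The sides of the bipartite part are the even and the odd numbers below \<open>2 * m\<close>, and \<open>2 * m\<close> is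
  the source.\<close>

definition bipartite_with_source :: "nat \<Rightarrow> nat pair_pre_digraph" where
  "bipartite_with_source m = \<lparr> pverts = {..2 * m},
    parcs = {(u, v). u \<le> 2 * m \<and> v < 2 * m \<and> (u = 2 * m \<or> even u \<noteq> even v)} \<rparr>"

lemma pair_digraph_bipartite_with_source: "pair_digraph (bipartite_with_source m)"
proof unfold_locales
  show "finite (parcs (bipartite_with_source m))"
    by (rule finite_subset[of _ "{..2 * m} \<times> {..2 * m}"])
      (auto simp: bipartite_with_source_def)
qed (auto simp: bipartite_with_source_def)

lemma min_out_degree_bipartite_with_source:
  "m \<le> min_out_degree (with_proj (bipartite_with_source m))"
proof -
  have "m \<le> card (parcs (bipartite_with_source m) `` {u})" if "u \<le> 2 * m" for u
  proof -
    \<comment> \<open>\<open>g\<close> enumerates the side opposite to \<open>u\<close>. The source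
      \<open>2 * m\<close> is even and gets the odd side, which lies in its
      out-neighbourhood.\<close>
    define g where "g i = 2 * i + (if even u then 1 else 0 :: nat)" for i
    have "g ` {..<m} \<subseteq> parcs (bipartite_with_source m) `` {u}"
      using that by (auto simp: g_def bipartite_with_source_def)
    moreover have "finite (parcs (bipartite_with_source m) `` {u})"
      by (rule finite_subset[of _ "{..2 * m}"]) (auto simp: bipartite_with_source_def)
    moreover have "inj_on g {..<m}" by (auto simp: g_def inj_on_def)
    ultimately show ?thesis
      by (metis card_image card_lessThan card_mono)
  qed
  then show ?thesis
    by (simp add: min_out_degree_def out_degree_with_proj) (simp add: bipartite_with_source_def)
qed

text \<open>The vertices \<open>0\<close>, \<open>1\<close> and \<open>2 * m\<close> form a triangle
  in the underlying graph.\<close>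

lemma not_colorable_bipartite_with_source:
  assumes "1 \<le> m"
  shows "\<not> colorable (with_proj (mk_symmetric (with_proj (bipartite_with_source m)))) 2"
proof
  assume "colorable (with_proj (mk_symmetric (with_proj (bipartite_with_source m)))) 2"
  then obtain c where c: "c ` {..2 * m} \<subseteq> {..<2::nat}"
    and arc: "\<And>u v. (u, v) \<in> parcs (bipartite_with_source m) \<Longrightarrow> c u \<noteq> c v"
    unfolding colorable_def by (fastforce simp: parcs_mk_symmetric bipartite_with_source_def)
  have "c (2 * m) \<noteq> c 0" "c (2 * m) \<noteq> c 1" "c 0 \<noteq> c 1"
    using assms by (auto intro!: arc simp: bipartite_with_source_def)
  moreover have "c 0 < 2" "c 1 < 2" "c (2 * m) < 2"
    using c assms by (auto simp: image_subset_iff)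
  ultimately show False by linarith
qed

lemma bipartite_with_source_no_odd_cycle:
  "\<not> contains_digraph (with_proj (directed_cycle (2 * l + 1))) (with_proj (bipartite_with_source m))"
proof
  interpret D: pair_digraph "bipartite_with_source m"
    by (rule pair_digraph_bipartite_with_source)
  let ?n = "2 * l + 1"
  assume "contains_digraph (with_proj (directed_cycle ?n)) (with_proj (bipartite_with_source m))"
  then obtain f where
    "map_prod f f ` parcs (directed_cycle ?n) \<subseteq> parcs (bipartite_with_source m)"
    unfolding contains_digraph_with_proj_iff[OF pair_wf_digraph_directed_cycle D.pair_wf_digraph_axioms]
    by blast
  then have arc: "(f i, f (Suc i mod ?n)) \<in> parcs (bipartite_with_source m)" if "i < ?n" for i
    using that by (auto simp: directed_cycle_def)
  \<comment> \<open>Every vertex of the cycle is the head of an arc, and no arc enters the source.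
    For \<open>i = 0\<close> this is the closing arc from \<open>2 * l\<close>.\<close>
  have "f i < 2 * m" if "i < ?n" for i
  proof (cases i)
    case 0
    then show ?thesis using arc[of "2 * l"] by (simp add: bipartite_with_source_def)
  next
    case (Suc j)
    then show ?thesis using arc[of j] that by (simp add: bipartite_with_source_def)
  qed
  then have parity: "even (f i) \<noteq> even (f (Suc i mod ?n))" if "i < ?n" for i
    using arc[OF that] that by (fastforce simp: bipartite_with_source_def)
  have "even (f i) \<longleftrightarrow> (even i \<longleftrightarrow> even (f 0))" if "i < ?n" for i
    using that
  proof (induction i)
    case (Suc i)
    then show ?case using parity[of i] by auto
  qed simp
  \<comment> \<open>Alternation gives \<open>f (2 * l)\<close> the parity of \<open>f 0\<close>, but
    the closing arc joins these two.\<close>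
  from this[of "2 * l"] show False using parity[of "2 * l"] by simp
qed

section \<open>The value of the infimum\<close>

theorem theorem1p3:
  fixes l :: nat
  assumes "l \<ge> 1"
  shows "chromatic_profile (with_proj (directed_cycle (2 * l + 1))) 2 = 1 / 2"
proof -
  define S where "S = {d :: real. \<exists>n\<^sub>0. \<forall>D :: nat pair_pre_digraph.
     pair_digraph D \<and> n\<^sub>0 \<le> card (pverts D) \<and>
     d * real (card (pverts D)) \<le> real (min_out_degree (with_proj D)) \<and>
     \<not> contains_digraph (with_proj (directed_cycle (2 * l + 1))) (with_proj D) \<longrightarrow>
     chromatic_number (with_proj D) \<le> 2}"
  \<comment> \<open>No large digraph meets both the degree bound and the exclusion of the cycle, so
    the implication is vacuous.\<close>
  have upper: "d \<in> S" if "1 / 2 < d" for d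
    using eventually_contains_directed_cycle[where 'a = nat, OF that, of "2 * l + 1"] assms
    by (auto simp: S_def pair_digraph_def)
  have lower: "1 / 2 \<le> d" if "d \<in> S" for d
  proof (rule ccontr)
    assume "\<not> 1 / 2 \<le> d"
    then have d: "0 < 1 - 2 * d" by simp
    from that obtain n\<^sub>0 where n0: "\<And>D :: nat pair_pre_digraph.
       \<lbrakk>pair_digraph D; n\<^sub>0 \<le> card (pverts D);
       d * real (card (pverts D)) \<le> real (min_out_degree (with_proj D));
       \<not> contains_digraph (with_proj (directed_cycle (2 * l + 1))) (with_proj D)\<rbrakk> \<Longrightarrow>
       chromatic_number (with_proj D) \<le> 2"
      unfolding S_def by blast
    \<comment> \<open>Solves \<open>d * (2 * m + 1) \<le> m\<close> for \<open>m\<close>, using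
      \<open>d < 1 / 2\<close>.\<close>
    obtain m\<^sub>0 :: nat where m0: "d / (1 - 2 * d) < real m\<^sub>0"
      using reals_Archimedean2 by blast
    \<comment> \<open>The summand \<open>n\<^sub>0\<close> makes the digraph large enough, and
      \<open>1\<close> guarantees the triangle.\<close>
    define m where "m = m\<^sub>0 + n\<^sub>0 + 1"
    let ?D = "bipartite_with_source m"
    have card: "card (pverts ?D) = 2 * m + 1"
      by (simp add: bipartite_with_source_def)
    have "d / (1 - 2 * d) < real m" using m0 by (simp add: m_def)
    then have "d * real (2 * m + 1) \<le> real m"
      using d by (simp add: field_simps)
    also have "\<dots> \<le> real (min_out_degree (with_proj ?D))"
      using min_out_degree_bipartite_with_source by simp
    finally have "d * real (card (pverts ?D)) \<le> real (min_out_degree (with_proj ?D))"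
      unfolding card .
    moreover have "n\<^sub>0 \<le> card (pverts ?D)"
      unfolding card by (simp add: m_def)
    ultimately have "chromatic_number (with_proj ?D) \<le> 2"
      using bipartite_with_source_no_odd_cycle pair_digraph_bipartite_with_source
      by (intro n0)
    then show False
      using not_colorable_bipartite_with_source[of m]
        pair_digraph.chromatic_number_le_iff[OF pair_digraph_bipartite_with_source]
      by (simp add: m_def)
  qed
  have "Inf S = 1 / 2"
  proof (rule antisym)
    show "Inf S \<le> 1 / 2"
    \<comment> \<open>Membership in \<open>S\<close> is known only strictly above
      \<open>1 / 2\<close>, so the bound is reached by density.\<close>
    proof (rule dense_ge)
      fix d :: real assume "1 / 2 < d"
      then show "Inf S \<le> d"
        using upper lower by (intro cInf_lower bdd_belowI)
    qed
    have "S \<noteq> {}" using upper[of 1] by auto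
    then show "1 / 2 \<le> Inf S" using lower by (rule cInf_greatest)
  qed
  then show ?thesis by (simp add: chromatic_profile_def S_def)
qed

end
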